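(* Let $R$ be a Noetherian, excellent, reduced ring containing a field of characteristic $p>0$, let $\mathfrak a\subseteq R$ be an ideal with $\mathfrak a\cap R^\circ\neq\emptyset$, and let $t>0$ be a real number. Then the set of $\mathfrak a^t$-sharp test elements of $R$ is equal to $\tau(\mathfrak a^t)\cap R^\circ$.
   Context: Rings are commutative with unit. $R^\circ$ is the set of elements of $R$ not contained in any minimal prime of $R$. For an ideal $I$, $I^{[p^e]}$ is the ideal generated by the $p^e$-th powers of elements of $I$. Convention: $\mathfrak a^0=R$. $\mathfrak a^t$-tight closure: for an ideal $I\subseteq R$, $I^{*\mathfrak a^t}$ is the set of $z\in R$ for which there exists $c\in R^\circ$ with $c\,\mathfrak a^{\lceil tp^e\rceil}z^{p^e}\subseteq I^{[p^e]}$ for all $e\gg0$. Generalized test ideal: $\tau(\mathfrak a^t)=\tau_R(\mathfrak a^t)=\bigcap_{J\subseteq R}(J:J^{*\mathfrak a^t})$, where $J$ runs over all ideals of $R$. An element $c\in R$ is an $\mathfrak a^t$-sharp test multiplier if for all ideals $I$ of $R$ and all $z\in I^{*\mathfrak a^t}$ one has $c\,\mathfrak a^{\lceil t(p^e-1)\rceil}z^{p^e}\subseteq I^{[p^e]}$ for all $e\ge0$. An $\mathfrak a^t$-sharp test element is an element $c\in R^\circ$ that is an $\mathfrak a^t$-sharp test multiplier. *)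

theory Defs
  imports Complex_Main "HOL-Library.Extended_Nat" "HOL-Algebra.Algebra"
begin

section \<open>Localization, completion, monoid rings and tensor products\<close>

text \<open>The fraction \<open>a/s\<close>, as the class of all pairs \<open>(b, t)\<close> with \<open>u a t = u b s\<close> for some
  \<open>u\<close> in the multiplicative set \<open>S\<close>.\<close>

definition frac_class :: "('a, 'm) ring_scheme \<Rightarrow> 'a set \<Rightarrow> 'a \<Rightarrow> 'a \<Rightarrow> ('a \<times> 'a) set" where
  "frac_class R S a s =
     {(b, t). b \<in> carrier R \<and> t \<in> S \<and>
              (\<exists>u\<in>S. u \<otimes>\<^bsub>R\<^esub> (a \<otimes>\<^bsub>R\<^esub> t) = u \<otimes>\<^bsub>R\<^esub> (b \<otimes>\<^bsub>R\<^esub> s))}"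

text \<open>In the operations below all members of the union are the same class.\<close>

definition localization :: "('a, 'm) ring_scheme \<Rightarrow> 'a set \<Rightarrow> ('a \<times> 'a) set ring" where
  "localization R S =
     \<lparr>carrier = {frac_class R S a s | a s. a \<in> carrier R \<and> s \<in> S},
      monoid.mult = (\<lambda>x y. \<Union>(a, s)\<in>x. \<Union>(b, t)\<in>y. frac_class R S (a \<otimes>\<^bsub>R\<^esub> b) (s \<otimes>\<^bsub>R\<^esub> t)),
      one = frac_class R S \<one>\<^bsub>R\<^esub> \<one>\<^bsub>R\<^esub>,
      ring.zero = frac_class R S \<zero>\<^bsub>R\<^esub> \<one>\<^bsub>R\<^esub>,
      add = (\<lambda>x y. \<Union>(a, s)\<in>x. \<Union>(b, t)\<in>y.
               frac_class R S ((a \<otimes>\<^bsub>R\<^esub> t) \<oplus>\<^bsub>R\<^esub> (b \<otimes>\<^bsub>R\<^esub> s)) (s \<otimes>\<^bsub>R\<^esub> t))\<rparr>"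

definition loc_map :: "('a, 'm) ring_scheme \<Rightarrow> 'a set \<Rightarrow> 'a \<Rightarrow> ('a \<times> 'a) set" where
  "loc_map R S a = frac_class R S a \<one>\<^bsub>R\<^esub>"

definition loc_at_prime :: "('a, 'm) ring_scheme \<Rightarrow> 'a set \<Rightarrow> ('a \<times> 'a) set ring" where
  "loc_at_prime R P = localization R (carrier R - P)"

text \<open>The residue field \<open>\<kappa>(Q)\<close> is the fraction field of \<open>R/Q\<close>.\<close>

definition residue_field :: "('a, 'm) ring_scheme \<Rightarrow> 'a set \<Rightarrow> ('a set \<times> 'a set) set ring" where
  "residue_field R Q = localization (R Quot Q) (carrier (R Quot Q) - {\<zero>\<^bsub>R Quot Q\<^esub>})"

definition residue_map :: "('a, 'm) ring_scheme \<Rightarrow> 'a set \<Rightarrow> 'a \<Rightarrow> ('a set \<times> 'a set) set" where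
  "residue_map R Q a = loc_map (R Quot Q) (carrier (R Quot Q) - {\<zero>\<^bsub>R Quot Q\<^esub>}) (Q +>\<^bsub>R\<^esub> a)"

text \<open>Ideal powers are powers in the semiring of ideals, so that the zeroth power is the whole
  ring.\<close>

abbreviation ideal_pow :: "('a, 'm) ring_scheme \<Rightarrow> 'a set \<Rightarrow> nat \<Rightarrow> 'a set" where
  "ideal_pow R I n \<equiv> I [^]\<^bsub>ideals_set R\<^esub> n"

text \<open>The \<open>I\<close>-adic completion, as the inverse limit of the \<open>R/I\<^sup>n\<close>: a coset of \<open>I\<^sup>n\<^sup>+\<^sup>1\<close> is mapped
  to a coset of \<open>I\<^sup>n\<close> iff it is contained in it.\<close>

definition completion :: "('a, 'm) ring_scheme \<Rightarrow> 'a set \<Rightarrow> (nat \<Rightarrow> 'a set) ring" where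
  "completion R I =
     \<lparr>carrier = {f. \<forall>n. f n \<in> carrier (R Quot ideal_pow R I n) \<and> f (Suc n) \<subseteq> f n},
      monoid.mult = (\<lambda>f g n. f n \<otimes>\<^bsub>R Quot ideal_pow R I n\<^esub> g n),
      one = (\<lambda>n. \<one>\<^bsub>R Quot ideal_pow R I n\<^esub>),
      ring.zero = (\<lambda>n. \<zero>\<^bsub>R Quot ideal_pow R I n\<^esub>),
      add = (\<lambda>f g n. f n \<oplus>\<^bsub>R Quot ideal_pow R I n\<^esub> g n)\<rparr>"

definition completion_map :: "('a, 'm) ring_scheme \<Rightarrow> 'a set \<Rightarrow> 'a \<Rightarrow> nat \<Rightarrow> 'a set" where
  "completion_map R I a = (\<lambda>n. ideal_pow R I n +>\<^bsub>R\<^esub> a)"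

text \<open>The monoid ring \<open>R[M]\<close>: finitely supported functions from \<open>M\<close> to \<open>R\<close> with convolution.\<close>

definition monoid_ring ::
  "('a, 'm) ring_scheme \<Rightarrow> ('i, 'n) monoid_scheme \<Rightarrow> ('i \<Rightarrow> 'a) ring" where
  "monoid_ring R M =
     \<lparr>carrier = {f. (\<forall>x. f x \<in> carrier R) \<and> (\<forall>x. x \<notin> carrier M \<longrightarrow> f x = \<zero>\<^bsub>R\<^esub>)
                    \<and> finite {x. f x \<noteq> \<zero>\<^bsub>R\<^esub>}},
      monoid.mult = (\<lambda>f g x. finsum R (\<lambda>(u, v). f u \<otimes>\<^bsub>R\<^esub> g v)
                 {(u, v). f u \<noteq> \<zero>\<^bsub>R\<^esub> \<and> g v \<noteq> \<zero>\<^bsub>R\<^esub> \<and> u \<otimes>\<^bsub>M\<^esub> v = x}),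
      one = (\<lambda>x. if x = \<one>\<^bsub>M\<^esub> then \<one>\<^bsub>R\<^esub> else \<zero>\<^bsub>R\<^esub>),
      ring.zero = (\<lambda>x. \<zero>\<^bsub>R\<^esub>),
      add = (\<lambda>f g x. f x \<oplus>\<^bsub>R\<^esub> g x)\<rparr>"

text \<open>\<open>R[x\<^sub>0, \<dots>, x\<^sub>n\<^sub>-\<^sub>1]\<close> is the monoid ring of the monomials, which are the multisets of variables.\<close>

definition poly_ring :: "('a, 'm) ring_scheme \<Rightarrow> nat \<Rightarrow> (nat multiset \<Rightarrow> 'a) ring" where
  "poly_ring R n =
     monoid_ring R \<lparr>carrier = {x. set_mset x \<subseteq> {..<n}}, monoid.mult = (+), one = {#}\<rparr>"

text \<open>The tensor product \<open>A \<otimes>\<^sub>K B\<close> of two commutative \<open>K\<close>-algebras given by \<open>\<phi> : K \<rightarrow> A\<close> and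
  \<open>\<psi> : K \<rightarrow> B\<close>. The free abelian group on the set \<open>A \<times> B\<close> is the integral monoid ring of the
  multiplicative monoid \<open>A \<times> B\<close>, which already carries the multiplication
  \<open>(a, b) (a', b') = (a a', b b')\<close>. The subgroup generated by the bilinearity relations is an ideal.\<close>

definition pure_elem :: "'i \<Rightarrow> 'i \<Rightarrow> int" where
  "pure_elem x = (\<lambda>y. if y = x then 1 else 0)"

definition tensor_relations ::
  "('k, 'l) ring_scheme \<Rightarrow> ('a, 'm) ring_scheme \<Rightarrow> ('k \<Rightarrow> 'a)
    \<Rightarrow> ('b, 'n) ring_scheme \<Rightarrow> ('k \<Rightarrow> 'b) \<Rightarrow> ('a \<times> 'b \<Rightarrow> int) set" where
  "tensor_relations K A \<phi> B \<psi> =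
     {\<lambda>y. pure_elem (a \<oplus>\<^bsub>A\<^esub> a', b) y - pure_elem (a, b) y - pure_elem (a', b) y | a a' b.
        a \<in> carrier A \<and> a' \<in> carrier A \<and> b \<in> carrier B}
   \<union> {\<lambda>y. pure_elem (a, b \<oplus>\<^bsub>B\<^esub> b') y - pure_elem (a, b) y - pure_elem (a, b') y | a b b'.
        a \<in> carrier A \<and> b \<in> carrier B \<and> b' \<in> carrier B}
   \<union> {\<lambda>y. pure_elem (\<phi> r \<otimes>\<^bsub>A\<^esub> a, b) y - pure_elem (a, \<psi> r \<otimes>\<^bsub>B\<^esub> b) y | r a b.
        r \<in> carrier K \<and> a \<in> carrier A \<and> b \<in> carrier B}"

definition tensor_ideal ::
  "('k, 'l) ring_scheme \<Rightarrow> ('a, 'm) ring_scheme \<Rightarrow> ('k \<Rightarrow> 'a)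
    \<Rightarrow> ('b, 'n) ring_scheme \<Rightarrow> ('k \<Rightarrow> 'b) \<Rightarrow> ('a \<times> 'b \<Rightarrow> int) set" where
  "tensor_ideal K A \<phi> B \<psi> = Idl\<^bsub>monoid_ring \<Z> (A \<times>\<times> B)\<^esub> (tensor_relations K A \<phi> B \<psi>)"

definition tensor_ring ::
  "('k, 'l) ring_scheme \<Rightarrow> ('a, 'm) ring_scheme \<Rightarrow> ('k \<Rightarrow> 'a)
    \<Rightarrow> ('b, 'n) ring_scheme \<Rightarrow> ('k \<Rightarrow> 'b) \<Rightarrow> ('a \<times> 'b \<Rightarrow> int) set ring" where
  "tensor_ring K A \<phi> B \<psi> = monoid_ring \<Z> (A \<times>\<times> B) Quot tensor_ideal K A \<phi> B \<psi>"

definition tensor_right ::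
  "('k, 'l) ring_scheme \<Rightarrow> ('a, 'm) ring_scheme \<Rightarrow> ('k \<Rightarrow> 'a)
    \<Rightarrow> ('b, 'n) ring_scheme \<Rightarrow> ('k \<Rightarrow> 'b) \<Rightarrow> 'b \<Rightarrow> ('a \<times> 'b \<Rightarrow> int) set" where
  "tensor_right K A \<phi> B \<psi> b =
     tensor_ideal K A \<phi> B \<psi> +>\<^bsub>monoid_ring \<Z> (A \<times>\<times> B)\<^esub> pure_elem (\<one>\<^bsub>A\<^esub>, b)"


section \<open>Excellent rings\<close>

definition prime_chain :: "('a, 'm) ring_scheme \<Rightarrow> nat \<Rightarrow> (nat \<Rightarrow> 'a set) \<Rightarrow> bool" where
  "prime_chain R n P \<longleftrightarrow> (\<forall>i\<le>n. primeideal (P i) R) \<and> (\<forall>i<n. P i \<subset> P (Suc i))"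

definition krull_dim :: "('a, 'm) ring_scheme \<Rightarrow> enat" where
  "krull_dim R = Sup {enat n | n. \<exists>P. prime_chain R n P}"

definition catenary :: "('a, 'm) ring_scheme \<Rightarrow> bool" where
  "catenary R \<longleftrightarrow>
     (\<forall>p q. primeideal p R \<and> primeideal q R \<and> p \<subseteq> q \<longrightarrow>
        (\<exists>N. (\<forall>n P. prime_chain R n P \<and> P 0 = p \<and> P n = q \<longrightarrow> n \<le> N) \<and>
             (\<forall>n P. prime_chain R n P \<and> P 0 = p \<and> P n = q \<and>
                    (\<forall>i<n. \<not> (\<exists>Q. primeideal Q R \<and> P i \<subset> Q \<and> Q \<subset> P (Suc i))) \<longrightarrow> n = N)))"

definition universally_catenary :: "('a, 'm) ring_scheme \<Rightarrow> bool" where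
  "universally_catenary R \<longleftrightarrow>
     noetherian_ring R \<and> (\<forall>n I. ideal I (poly_ring R n) \<longrightarrow> catenary (poly_ring R n Quot I))"

definition local_ring :: "('a, 'm) ring_scheme \<Rightarrow> bool" where
  "local_ring R \<longleftrightarrow> cring R \<and> (\<exists>!M. maximalideal M R)"

definition the_maximal_ideal :: "('a, 'm) ring_scheme \<Rightarrow> 'a set" where
  "the_maximal_ideal R = (THE M. maximalideal M R)"

definition regular_local_ring :: "('a, 'm) ring_scheme \<Rightarrow> bool" where
  "regular_local_ring R \<longleftrightarrow>
     local_ring R \<and> noetherian_ring R \<and>
     (\<exists>G\<subseteq>carrier R. finite G \<and> the_maximal_ideal R = Idl\<^bsub>R\<^esub> G \<and> enat (card G) = krull_dim R)"

definition regular_ring :: "('a, 'm) ring_scheme \<Rightarrow> bool" where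
  "regular_ring R \<longleftrightarrow>
     cring R \<and> noetherian_ring R \<and> (\<forall>P. primeideal P R \<longrightarrow> regular_local_ring (loc_at_prime R P))"

text \<open>Every finite extension \<open>L\<close> of a field \<open>K\<close> is in bijection with some \<open>K\<^sup>n\<close>, so up to isomorphism
  its elements may be taken from the type of sequences in \<open>K\<close>.\<close>

definition finite_field_extension ::
  "('k, 'l) ring_scheme \<Rightarrow> ('b, 'n) ring_scheme \<Rightarrow> ('k \<Rightarrow> 'b) \<Rightarrow> bool" where
  "finite_field_extension K L \<psi> \<longleftrightarrow>
     field K \<and> field L \<and> \<psi> \<in> ring_hom K L \<and>
     (\<exists>n. ring.dimension L n (\<psi> ` carrier K) (carrier L))"

definition geometrically_regular ::
  "('k, 'l) ring_scheme \<Rightarrow> ('a, 'm) ring_scheme \<Rightarrow> ('k \<Rightarrow> 'a) \<Rightarrow> bool" where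
  "geometrically_regular K A \<phi> \<longleftrightarrow>
     (\<forall>(L :: (nat \<Rightarrow> 'k) ring) \<psi>. finite_field_extension K L \<psi> \<longrightarrow>
        regular_ring (tensor_ring K A \<phi> L \<psi>))"

text \<open>For a local ring \<open>A\<close> with completion \<open>C\<close>, the formal fibre over a prime \<open>Q\<close> of \<open>A\<close> is the
  \<open>\<kappa>(Q)\<close>-algebra \<open>C \<otimes>\<^sub>A \<kappa>(Q)\<close>.\<close>

definition formal_fibre_regular :: "('a, 'm) ring_scheme \<Rightarrow> 'a set \<Rightarrow> bool" where
  "formal_fibre_regular A Q \<longleftrightarrow>
     (let C = completion A (the_maximal_ideal A);
          \<gamma> = completion_map A (the_maximal_ideal A);
          k = residue_field A Q;
          \<rho> = residue_map A Q
      in geometrically_regular k (tensor_ring A C \<gamma> k \<rho>) (tensor_right A C \<gamma> k \<rho>))"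

definition G_ring :: "('a, 'm) ring_scheme \<Rightarrow> bool" where
  "G_ring R \<longleftrightarrow>
     noetherian_ring R \<and>
     (\<forall>P Q. primeideal P R \<and> primeideal Q (loc_at_prime R P) \<longrightarrow>
        formal_fibre_regular (loc_at_prime R P) Q)"

text \<open>The open subsets of the spectrum are the sets of primes not containing a given ideal.\<close>

definition open_regular_locus :: "('a, 'm) ring_scheme \<Rightarrow> bool" where
  "open_regular_locus R \<longleftrightarrow>
     (\<exists>I. ideal I R \<and>
        (\<forall>P. primeideal P R \<longrightarrow> (regular_local_ring (loc_at_prime R P) \<longleftrightarrow> \<not> I \<subseteq> P)))"

definition J2_ring :: "('a, 'm) ring_scheme \<Rightarrow> bool" where
  "J2_ring R \<longleftrightarrow>
     noetherian_ring R \<and>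
     (\<forall>n I. ideal I (poly_ring R n) \<longrightarrow> open_regular_locus (poly_ring R n Quot I))"

definition excellent_ring :: "('a, 'm) ring_scheme \<Rightarrow> bool" where
  "excellent_ring R \<longleftrightarrow>
     cring R \<and> noetherian_ring R \<and> universally_catenary R \<and> G_ring R \<and> J2_ring R"


section \<open>Tight closure and test ideals\<close>

definition reduced_ring :: "('a, 'm) ring_scheme \<Rightarrow> bool" where
  "reduced_ring R \<longleftrightarrow> cring R \<and> (\<forall>x\<in>carrier R. \<forall>n::nat. x [^]\<^bsub>R\<^esub> n = \<zero>\<^bsub>R\<^esub> \<longrightarrow> x = \<zero>\<^bsub>R\<^esub>)"

definition ring_characteristic :: "('a, 'm) ring_scheme \<Rightarrow> nat" where
  "ring_characteristic R =
     (if \<exists>n::nat. n > 0 \<and> add_pow R n \<one>\<^bsub>R\<^esub> = \<zero>\<^bsub>R\<^esub>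
      then LEAST n::nat. n > 0 \<and> add_pow R n \<one>\<^bsub>R\<^esub> = \<zero>\<^bsub>R\<^esub> else 0)"

definition minimal_prime :: "('a, 'm) ring_scheme \<Rightarrow> 'a set \<Rightarrow> bool" where
  "minimal_prime R P \<longleftrightarrow> primeideal P R \<and> (\<forall>Q. primeideal Q R \<and> Q \<subseteq> P \<longrightarrow> Q = P)"

definition ring_circ :: "('a, 'm) ring_scheme \<Rightarrow> 'a set" where
  "ring_circ R = {c \<in> carrier R. \<forall>P. minimal_prime R P \<longrightarrow> c \<notin> P}"

definition frob_power :: "('a, 'm) ring_scheme \<Rightarrow> nat \<Rightarrow> 'a set \<Rightarrow> nat \<Rightarrow> 'a set" where
  "frob_power R p I e = Idl\<^bsub>R\<^esub> ((\<lambda>x. x [^]\<^bsub>R\<^esub> (p ^ e)) ` I)"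

definition tight_closure ::
  "('a, 'm) ring_scheme \<Rightarrow> nat \<Rightarrow> 'a set \<Rightarrow> real \<Rightarrow> 'a set \<Rightarrow> 'a set" where
  "tight_closure R p \<aa> t I =
     {z \<in> carrier R. \<exists>c\<in>ring_circ R. \<exists>e\<^sub>0. \<forall>e\<ge>e\<^sub>0.
        \<forall>y\<in>ideal_pow R \<aa> (nat \<lceil>t * real p ^ e\<rceil>).
          c \<otimes>\<^bsub>R\<^esub> y \<otimes>\<^bsub>R\<^esub> z [^]\<^bsub>R\<^esub> (p ^ e) \<in> frob_power R p I e}"

definition colon :: "('a, 'm) ring_scheme \<Rightarrow> 'a set \<Rightarrow> 'a set \<Rightarrow> 'a set" where
  "colon R I J = {r \<in> carrier R. \<forall>x\<in>J. r \<otimes>\<^bsub>R\<^esub> x \<in> I}"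

definition test_ideal :: "('a, 'm) ring_scheme \<Rightarrow> nat \<Rightarrow> 'a set \<Rightarrow> real \<Rightarrow> 'a set" where
  "test_ideal R p \<aa> t = (\<Inter>J\<in>{J. ideal J R}. colon R J (tight_closure R p \<aa> t J))"

definition sharp_test_multiplier ::
  "('a, 'm) ring_scheme \<Rightarrow> nat \<Rightarrow> 'a set \<Rightarrow> real \<Rightarrow> 'a \<Rightarrow> bool" where
  "sharp_test_multiplier R p \<aa> t c \<longleftrightarrow>
     c \<in> carrier R \<and>
     (\<forall>I. ideal I R \<longrightarrow> (\<forall>z\<in>tight_closure R p \<aa> t I. \<forall>e.
        \<forall>y\<in>ideal_pow R \<aa> (nat \<lceil>t * (real p ^ e - 1)\<rceil>).
          c \<otimes>\<^bsub>R\<^esub> y \<otimes>\<^bsub>R\<^esub> z [^]\<^bsub>R\<^esub> (p ^ e) \<in> frob_power R p I e))"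

definition sharp_test_element ::
  "('a, 'm) ring_scheme \<Rightarrow> nat \<Rightarrow> 'a set \<Rightarrow> real \<Rightarrow> 'a \<Rightarrow> bool" where
  "sharp_test_element R p \<aa> t c \<longleftrightarrow> c \<in> ring_circ R \<and> sharp_test_multiplier R p \<aa> t c"

end

theory Submission
  imports Defs
begin

text \<open>Write \<open>q = p\<^sup>e\<close>. The case \<open>e = 0\<close> of the multiplier condition says \<open>c z \<in> I\<close>, because
  \<open>\<aa>\<^sup>0 = R\<close>; hence sharp test elements lie in the test ideal.

  Conversely, if \<open>z\<close> is in the \<open>\<aa>\<^sup>t\<close>-tight closure of \<open>I\<close> and \<open>y \<in> \<aa>\<^bsup>\<lceil>t(q - 1)\<rceil>\<^esup>\<close>, then \<open>y z\<^sup>q\<close> is in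
  the \<open>\<aa>\<^sup>t\<close>-tight closure of \<open>I\<^bsup>[q]\<^esup>\<close>. For \<open>q' = p\<^sup>e\<^sup>'\<close> one has
  \<open>\<aa>\<^bsup>\<lceil>tq'\<rceil>\<^esup> y\<^sup>q\<^sup>' \<subseteq> \<aa>\<^bsup>\<lceil>tqq'\<rceil>\<^esup>\<close>, since \<open>\<lceil>tq'\<rceil> + q'\<lceil>t(q - 1)\<rceil> \<ge> tqq'\<close>. So the element \<open>d\<close> that witnesses
  the membership of \<open>z\<close> satisfies \<open>d \<aa>\<^bsup>\<lceil>tq'\<rceil>\<^esup> (y z\<^sup>q)\<^sup>q\<^sup>' \<subseteq> I\<^bsup>[qq']\<^esup> \<subseteq> (I\<^bsup>[q]\<^esup>)\<^bsup>[q']\<^esup>\<close> for large \<open>e'\<close> and is a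
  witness for \<open>y z\<^sup>q\<close> too. An element of the test ideal multiplies the tight closure of \<open>I\<^bsup>[q]\<^esup>\<close>
  into \<open>I\<^bsup>[q]\<^esup>\<close>, and this is the multiplier condition.\<close>

context cring
begin

lemma ideal_pow_is_ideal:
  assumes "ideal I R"
  shows "ideal (ideal_pow R I n) R"
proof -
  interpret ideals: comm_monoid "ideals_set R"
    by (rule ideals_set_is_comm_monoid)
  show ?thesis
    using ideals.nat_pow_closed[of I n] assms by (simp add: ideals_set_def)
qed

lemma ideal_pow_add:
  assumes "ideal I R"
  shows "ideal_pow R I (m + n) = ideal_prod R (ideal_pow R I m) (ideal_pow R I n)"
proof -
  interpret ideals: comm_monoid "ideals_set R"
    by (rule ideals_set_is_comm_monoid)
  show ?thesis
    using ideals.nat_pow_mult[of I m n] assms by (simp add: ideals_set_def)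
qed

lemma ideal_pow_antimono:
  assumes "ideal I R" "m \<le> n"
  shows "ideal_pow R I n \<subseteq> ideal_pow R I m"
proof -
  have "ideal_pow R I (m + (n - m)) \<subseteq> ideal_pow R I m"
    unfolding ideal_pow_add[OF assms(1)]
    using ideal_prod_inter ideal_pow_is_ideal[OF assms(1)] by blast
  then show ?thesis
    using assms(2) by simp
qed

lemma mult_in_ideal_pow_add:
  assumes "ideal I R" "x \<in> ideal_pow R I m" "y \<in> ideal_pow R I n"
  shows "x \<otimes> y \<in> ideal_pow R I (m + n)"
  using assms by (simp add: ideal_pow_add ideal_prod.prod)

lemma pow_in_ideal_pow_mult:
  assumes "ideal I R" "x \<in> ideal_pow R I n"
  shows "x [^] (k::nat) \<in> ideal_pow R I (k * n)"
proof (induction k)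
  case 0
  then show ?case
    by (simp add: ideals_set_def)
next
  case (Suc k)
  show ?case
    using mult_in_ideal_pow_add[OF assms(1) Suc assms(2)] by (simp add: add.commute)
qed

lemma frob_power_is_ideal:
  assumes "ideal I R"
  shows "ideal (frob_power R p I e) R"
  unfolding frob_power_def
  using ideal.Icarr[OF assms] by (intro genideal_ideal) auto

lemma frob_power_0:
  assumes "ideal I R"
  shows "frob_power R p I 0 = I"
proof -
  have "(\<lambda>x. x [^] (p ^ 0)) ` I = I"
    using ideal.Icarr[OF assms] by (force simp: nat_pow_eone)
  then show ?thesis
    unfolding frob_power_def
    using genideal_minimal[OF assms subset_refl] genideal_self ideal.Icarr[OF assms] by auto
qed

lemma frob_power_add_subset:
  assumes "ideal I R"
  shows "frob_power R p I (e + e') \<subseteq> frob_power R p (frob_power R p I e) e'"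
proof -
  have sub: "(\<lambda>x. x [^] (p ^ e)) ` I \<subseteq> frob_power R p I e"
    unfolding frob_power_def
    using ideal.Icarr[OF assms] by (intro genideal_self) auto
  have J: "ideal (frob_power R p I e) R"
    by (rule frob_power_is_ideal[OF assms])
  have sub': "(\<lambda>x. x [^] (p ^ e')) ` frob_power R p I e
      \<subseteq> frob_power R p (frob_power R p I e) e'"
    unfolding frob_power_def[of R p "frob_power R p I e"]
    using ideal.Icarr[OF J] by (intro genideal_self) auto
  have "x [^] (p ^ (e + e')) \<in> frob_power R p (frob_power R p I e) e'" if "x \<in> I" for x
  proof -
    have "x [^] (p ^ (e + e')) = (x [^] (p ^ e)) [^] (p ^ e')"
      using that ideal.Icarr[OF assms] by (simp add: nat_pow_pow power_add)
    then show ?thesis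
      using that sub sub' by auto
  qed
  then show ?thesis
    unfolding frob_power_def[of R p I "e + e'"]
    by (intro genideal_minimal frob_power_is_ideal J) auto
qed

end

lemma ceiling_exponent_bound:
  fixes t a :: real and m :: nat
  shows "nat \<lceil>t * (a * real m)\<rceil> \<le> nat \<lceil>t * real m\<rceil> + m * nat \<lceil>t * (a - 1)\<rceil>"
proof -
  have "t * (a * real m) = t * real m + real m * (t * (a - 1))"
    by (simp add: algebra_simps)
  also have "\<dots> \<le> real (nat \<lceil>t * real m\<rceil>) + real m * real (nat \<lceil>t * (a - 1)\<rceil>)"
    by (intro add_mono mult_left_mono real_nat_ceiling_ge) auto
  finally have "t * (a * real m) \<le> real (nat \<lceil>t * real m\<rceil> + m * nat \<lceil>t * (a - 1)\<rceil>)"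
    by simp
  then show ?thesis
    by linarith
qed

text \<open>The witness \<open>d\<close> for \<open>z\<close> is reused: the condition on \<open>y z\<^sup>q\<close> at level \<open>e'\<close> follows from
  the condition on \<open>z\<close> at level \<open>e + e'\<close>.\<close>

lemma (in cring) tight_closure_frobenius_step:
  assumes \<aa>: "ideal \<aa> R" and I: "ideal I R"
    and z: "z \<in> tight_closure R p \<aa> t I"
    and y: "y \<in> ideal_pow R \<aa> (nat \<lceil>t * (real p ^ e - 1)\<rceil>)"
  shows "y \<otimes> z [^] (p ^ e) \<in> tight_closure R p \<aa> t (frob_power R p I e)"
proof -
  from z obtain d e0 where zc: "z \<in> carrier R" and d: "d \<in> ring_circ R"
    and wit: "\<And>e' x. e' \<ge> e0 \<Longrightarrow> x \<in> ideal_pow R \<aa> (nat \<lceil>t * real p ^ e'\<rceil>) \<Longrightarrow>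
      d \<otimes> x \<otimes> z [^] (p ^ e') \<in> frob_power R p I e'"
    unfolding tight_closure_def by auto
  have dc: "d \<in> carrier R"
    using d unfolding ring_circ_def by simp
  have yc: "y \<in> carrier R"
    using y ideal.Icarr[OF ideal_pow_is_ideal[OF \<aa>]] by blast
  have "d \<otimes> x \<otimes> (y \<otimes> z [^] (p ^ e)) [^] (p ^ e')
      \<in> frob_power R p (frob_power R p I e) e'"
    if e': "e' \<ge> e0" and x: "x \<in> ideal_pow R \<aa> (nat \<lceil>t * real p ^ e'\<rceil>)" for e' x
  proof -
    have xc: "x \<in> carrier R"
      using x ideal.Icarr[OF ideal_pow_is_ideal[OF \<aa>]] by blast
    have "x \<otimes> y [^] (p ^ e')
        \<in> ideal_pow R \<aa> (nat \<lceil>t * real p ^ e'\<rceil> + p ^ e' * nat \<lceil>t * (real p ^ e - 1)\<rceil>)"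
      by (intro mult_in_ideal_pow_add pow_in_ideal_pow_mult \<aa> x y)
    moreover have "nat \<lceil>t * real p ^ (e + e')\<rceil>
        \<le> nat \<lceil>t * real p ^ e'\<rceil> + p ^ e' * nat \<lceil>t * (real p ^ e - 1)\<rceil>"
      using ceiling_exponent_bound[of t "real p ^ e" "p ^ e'"] by (simp add: power_add)
    ultimately have "x \<otimes> y [^] (p ^ e') \<in> ideal_pow R \<aa> (nat \<lceil>t * real p ^ (e + e')\<rceil>)"
      using ideal_pow_antimono[OF \<aa>] by blast
    then have "d \<otimes> (x \<otimes> y [^] (p ^ e')) \<otimes> z [^] (p ^ (e + e')) \<in> frob_power R p I (e + e')"
      using e' by (intro wit) auto
    moreover have "d \<otimes> (x \<otimes> y [^] (p ^ e')) \<otimes> z [^] (p ^ (e + e'))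
        = d \<otimes> x \<otimes> (y \<otimes> z [^] (p ^ e)) [^] (p ^ e')"
      using dc xc yc zc by (simp add: nat_pow_distrib nat_pow_pow power_add m_assoc)
    ultimately show ?thesis
      using frob_power_add_subset[OF I] by auto
  qed
  then show ?thesis
    unfolding tight_closure_def using d yc zc by auto
qed

lemma (in cring) sharp_test_multiplier_imp_test_ideal:
  assumes "sharp_test_multiplier R p \<aa> t c"
  shows "c \<in> test_ideal R p \<aa> t"
proof -
  have cc: "c \<in> carrier R"
    using assms unfolding sharp_test_multiplier_def by simp
  have "c \<otimes> z \<in> J" if J: "ideal J R" and z: "z \<in> tight_closure R p \<aa> t J" for J z
  proof -
    have zc: "z \<in> carrier R"
      using z unfolding tight_closure_def by simp
    have one: "\<one> \<in> ideal_pow R \<aa> (nat \<lceil>t * (real p ^ 0 - 1)\<rceil>)"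
      by (simp add: ideals_set_def)
    have "c \<otimes> \<one> \<otimes> z [^] (p ^ 0) \<in> frob_power R p J 0"
      using assms J z one unfolding sharp_test_multiplier_def by blast
    then show ?thesis
      using cc zc frob_power_0[OF J] by (simp add: nat_pow_eone)
  qed
  then show ?thesis
    unfolding test_ideal_def colon_def using cc by auto
qed

lemma (in cring) test_ideal_imp_sharp_test_multiplier:
  assumes "ideal \<aa> R" and c: "c \<in> test_ideal R p \<aa> t"
  shows "sharp_test_multiplier R p \<aa> t c"
proof -
  have cc: "c \<in> carrier R"
    using c oneideal unfolding test_ideal_def colon_def by auto
  have mult: "c \<otimes> w \<in> J" if "ideal J R" "w \<in> tight_closure R p \<aa> t J" for J w
    using c that unfolding test_ideal_def colon_def by auto
  have "c \<otimes> y \<otimes> z [^] (p ^ e) \<in> frob_power R p I e"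
    if I: "ideal I R" and z: "z \<in> tight_closure R p \<aa> t I"
      and y: "y \<in> ideal_pow R \<aa> (nat \<lceil>t * (real p ^ e - 1)\<rceil>)" for I z e y
  proof -
    have "c \<otimes> (y \<otimes> z [^] (p ^ e)) \<in> frob_power R p I e"
      by (intro mult frob_power_is_ideal tight_closure_frobenius_step assms(1) I z y)
    moreover have "z \<in> carrier R"
      using z unfolding tight_closure_def by simp
    moreover have "y \<in> carrier R"
      using y ideal.Icarr[OF ideal_pow_is_ideal[OF assms(1)]] by blast
    ultimately show ?thesis
      using cc by (simp add: m_assoc)
  qed
  then show ?thesis
    unfolding sharp_test_multiplier_def using cc by blast
qed

theorem corollary2p8:
  fixes R :: "('a, 'm) ring_scheme" and p :: nat and \<aa> :: "'a set" and t :: real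
  assumes "cring R" and "noetherian_ring R" and "excellent_ring R" and "reduced_ring R"
    and "p > 0" and "\<exists>K. subfield K R \<and> ring_characteristic (R\<lparr>carrier := K\<rparr>) = p"
    and "ideal \<aa> R" and "\<aa> \<inter> ring_circ R \<noteq> {}"
    and "t > 0"
  shows "{c. sharp_test_element R p \<aa> t c} = test_ideal R p \<aa> t \<inter> ring_circ R"
  using cring.sharp_test_multiplier_imp_test_ideal[OF assms(1)]
    cring.test_ideal_imp_sharp_test_multiplier[OF assms(1,7)]
  unfolding sharp_test_element_def by blast

end
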